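(* Let $N \ge 0$ be an integer, let $c_0, c_1, \dots, c_N \in \mathbb{C}$, and let $m_0 < m_1 < \cdots < m_N$ be nonnegative integers. Suppose the polynomial $$P(z) = c_0 z^{m_0} + c_1 z^{m_1} + \cdots + c_N z^{m_N} \in \mathbb{C}[z]$$ is not identically zero. Then $$|c_n| \le \binom{N}{n}\, \mathfrak{M}(P) \quad \text{for each } n = 0, 1, 2, \dots, N.$$
   Context: For a nonzero polynomial $P \in \mathbb{C}[z]$, its Mahler measure is $\mathfrak{M}(P) = \exp\left(\int_0^1 \log|P(e^{2\pi i t})|\,dt\right)$; equivalently, if $P(z) = c\prod_{n}(z-\alpha_n)$ with leading coefficient $c$, then $\mathfrak{M}(P) = |c|\prod_n \max\{1,|\alpha_n|\}$. *)

theory Defs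
  imports "HOL-Analysis.Analysis" "HOL-Computational_Algebra.Polynomial"
begin

text \<open>The junk value \<open>ln 0 = 0\<close> is harmless: for nonzero \<open>P\<close> it
  affects only finitely many \<open>t \<in> [0, 1]\<close>.\<close>

definition mahler_measure :: "complex poly \<Rightarrow> real" where
  "mahler_measure P =
     exp (LBINT t:{0..1}. ln (cmod (poly P (exp (2 * of_real pi * \<i> * of_real t)))))"

end

theory Submission
  imports Defs "HOL-Computational_Algebra.Fundamental_Theorem_Algebra"
begin

text \<open>
  Induction on \<open>N\<close>. The Mahler measure ignores powers of \<open>z\<close>, so let \<open>m 0 = 0\<close> and put \<open>d = m N\<close>. Both
  \<open>z P'\<close> and \<open>d P - z P'\<close> have one term less than \<open>P\<close>, with coefficients \<open>m n * c n\<close> and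
  \<open>(d - m n) * c n\<close>. If both have Mahler measure at most \<open>d\<close> times that of \<open>P\<close>, then adding the two
  bounds from the induction hypothesis and using Pascal's rule gives the claim.

  For these two estimates (the first is due to Mahler) reflect the roots of \<open>P\<close> outside the unit disc
  to its inside. This yields \<open>Q\<close> with \<open>\<bar>Q\<bar> = \<bar>P\<bar>\<close> on the unit circle, where comparing the terms
  \<open>z / (z - a)\<close> of the logarithmic derivatives shows that \<open>\<bar>Q'\<bar>\<close> dominates both polynomials. As \<open>Q\<close>
  and, by Gauss--Lucas, \<open>Q'\<close> have all roots in the closed unit disc, their Mahler measures are the
  absolute values of their leading coefficients, which differ by the factor \<open>d\<close>.
\<close>

subsection \<open>The integral of \<open>ln \<bar>z - a\<bar>\<close> over the unit circle\<close>

text \<open>Cut \<open>{0..1}\<close> at \<open>a\<close>: translation by \<open>a\<close> and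
  periodicity move the two pieces to \<open>{1 - a..1}\<close> and \<open>{0..1 - a}\<close>, merely
  swapping their order.\<close>

lemma has_integral_periodic_shift:
  fixes f :: "real \<Rightarrow> real"
  assumes f: "(f has_integral I) {0..1}" and per: "\<And>t. f (t + 1) = f t" and a: "0 \<le> a" "a \<le> 1"
  shows "((\<lambda>t. f (t + a)) has_integral I) {0..1}"
proof -
  have int: "f integrable_on {0..1}" using f by blast
  have i1: "f integrable_on {0..a}" "f integrable_on {a..1}"
    by (rule integrable_on_subinterval[OF int]; use a in auto)+
  let ?A = "integral {0..a} f" and ?B = "integral {a..1} f"
  have h: "(f has_integral ?A) {0..a}" "(f has_integral ?B) {a..1}"
    using i1 by (auto intro: integrable_integral)
  have "I = ?A + ?B"
    using has_integral_combine[OF a h] f has_integral_unique by blast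
  moreover have "((\<lambda>t. f (t + a)) has_integral ?B) {0..1 - a}"
    using has_integral_affinity'[of f ?B a 1 1 a] h(2) by simp
  moreover have "((\<lambda>t. f (t + a)) has_integral ?A) {1 - a..1}"
  proof -
    have "((\<lambda>t. f (t + (a - 1))) has_integral ?A) {1 - a..1}"
      using has_integral_affinity'[of f ?A 0 a 1 "a - 1"] h(1) by simp
    moreover have "f (t + (a - 1)) = f (t + a)" for t
      using per[of "t + (a - 1)"] by (simp add: algebra_simps)
    ultimately show ?thesis by simp
  qed
  ultimately show ?thesis
    using has_integral_combine[of 0 "1 - a" 1 "\<lambda>t. f (t + a)" ?B ?A] a
    by (simp add: add.commute)
qed

lemma has_integral_periodic_double:
  fixes f :: "real \<Rightarrow> real"
  assumes f: "(f has_integral I) {0..1}" and per: "\<And>t. f (t + 1) = f t"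
  shows "((\<lambda>t. f (2 * t)) has_integral I) {0..1}"
proof -
  have "((\<lambda>t. f (2 * t)) has_integral I / 2) {0..1 / 2}"
    using has_integral_affinity'[of f I 0 1 2 0] f by (simp add: field_simps)
  moreover have "((\<lambda>t. f (2 * t + (- 1))) has_integral I / 2) {1 / 2..1}"
    using has_integral_affinity'[of f I 0 1 2 "- 1"] f by (simp add: field_simps)
  moreover have "f (2 * t + (- 1)) = f (2 * t)" for t
    using per[of "2 * t + (- 1)"] by simp
  ultimately show ?thesis
    using has_integral_combine[of 0 "1 / 2" 1 "\<lambda>t. f (2 * t)" "I / 2" "I / 2"] by simp
qed

lemma cis_two_pi_periodic: "cis (2 * pi * (t + 1)) = cis (2 * pi * t)"
  by (simp add: distrib_left flip: cis_mult)

lemma cis_two_pi_half: "cis (2 * pi * (t + 1 / 2)) = - cis (2 * pi * t)"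
  by (simp add: distrib_left flip: cis_mult)

lemma inj_on_cis_two_pi: "inj_on (\<lambda>t. cis (2 * pi * t)) {0..<1}"
proof (rule inj_onI)
  fix s t :: real
  assume st: "s \<in> {0..<1}" "t \<in> {0..<1}" and "cis (2 * pi * s) = cis (2 * pi * t)"
  then have "sin (2 * pi * s) = sin (2 * pi * t)" "cos (2 * pi * s) = cos (2 * pi * t)"
    by (auto simp: complex_eq_iff)
  then obtain n :: int where "2 * pi * s = 2 * pi * t + 2 * pi * n"
    using sin_cos_eq_iff by blast
  then have "2 * pi * (s - t - n) = 0" by (simp add: algebra_simps)
  then have "s = t + n" by simp
  with st show "s = t" by simp
qed

lemma finite_unit_circle_roots:
  fixes P :: "complex poly"
  assumes "P \<noteq> 0"
  shows "finite {t \<in> {0..1}. poly P (cis (2 * pi * t)) = 0}"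
proof -
  have "finite ((\<lambda>t. cis (2 * pi * t)) -` {z. poly P z = 0} \<inter> {0..<1})"
    by (rule finite_vimage_IntI[OF poly_roots_finite[OF assms] inj_on_cis_two_pi])
  \<comment> \<open>Injectivity holds only on the half-open interval; the endpoint 1 names the same
    point of the circle as 0.\<close>
  then have "finite (insert 1 ((\<lambda>t. cis (2 * pi * t)) -` {z. poly P z = 0} \<inter> {0..<1}))"
    by simp
  then show ?thesis by (rule rev_finite_subset) auto
qed

section \<open>Integrability at the logarithmic singularity\<close>

lemma sin_pi_ge:
  assumes "0 \<le> t" "t \<le> 1"
  shows "2 * t * (1 - t) \<le> sin (pi * t)"
proof -
  have convex: "convex_on {0..pi} (\<lambda>x. - sin x)"
    by (rule f''_ge0_imp_convex[where f' = "\<lambda>x. - cos x" and f'' = sin])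
       (auto intro!: derivative_eq_intros sin_ge_zero)
  \<comment> \<open>The sine is concave on \<open>{0..pi}\<close>, and this is its chord from 0 to
    \<open>pi / 2\<close>.\<close>
  have half: "2 * t \<le> sin (pi * t)" if "0 \<le> t" "t \<le> 1 / 2" for t
    using convex_onD[OF convex, of "2 * t" 0 "pi / 2"] that by (simp add: mult.commute)
  show ?thesis
  proof (cases "t \<le> 1 / 2")
    case True
    have "2 * t * (1 - t) \<le> 2 * t * 1" using assms by (intro mult_left_mono) auto
    then show ?thesis using half[of t] assms True by simp
  next
    case False
    have "2 * (1 - t) * t \<le> 2 * (1 - t) * 1" using assms by (intro mult_left_mono) auto
    moreover have "sin (pi * (1 - t)) = sin (pi * t)"
      by (simp add: right_diff_distrib sin_diff)
    ultimately show ?thesis using half[of "1 - t"] assms False by (simp add: algebra_simps)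
  qed
qed

text \<open>This is \<open>ln x < x\<close> at \<open>x = t powr (- 1 / 2)\<close>; it dominates the
  logarithm by an integrable power.\<close>

lemma abs_ln_le_inverse_sqrt:
  fixes t :: real
  assumes "0 \<le> t" "t \<le> 1"
  shows "\<bar>ln t\<bar> \<le> 2 * t powr (- 1 / 2)"
proof (cases "t = 0")
  case False
  have "ln (t powr (- 1 / 2)) \<le> t powr (- 1 / 2)"
    using False assms by (intro less_imp_le ln_less_self) auto
  then show ?thesis using assms False by (simp add: ln_powr)
qed simp

lemma cmod_cis_minus_one: "cmod (cis (2 * pi * t) - 1) = 2 * \<bar>sin (pi * t)\<bar>"
proof -
  have "(cmod (cis (2 * pi * t) - 1))\<^sup>2 = (cos (2 * (pi * t)) - 1)\<^sup>2 + (sin (2 * (pi * t)))\<^sup>2"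
    by (simp add: cmod_power2 mult.assoc)
  also have "\<dots> = 2 - 2 * cos (2 * (pi * t))"
    using sin_cos_squared_add[of "2 * (pi * t)"] by (simp add: power2_diff)
  also have "\<dots> = (2 * \<bar>sin (pi * t)\<bar>)\<^sup>2"
    by (simp add: cos_double_sin power_mult_distrib)
  finally show ?thesis
    by (rule power2_eq_imp_eq) auto
qed

lemma borel_measurable_ln_cmod_poly_cis:
  "(\<lambda>t. ln (cmod (poly P (cis (2 * pi * t))))) \<in> borel_measurable borel"
  by (intro borel_measurable_ln borel_measurable_continuous_onI continuous_intros)

text \<open>The singularities sit at the endpoints 0 and 1. The terms of \<open>?g\<close> with
  exponent -1/2 absorb one each, and \<open>ln 2\<close> covers the values above 1.\<close>

lemma integrable_ln_cmod_cis_minus_one: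
  "(\<lambda>t. ln (cmod (cis (2 * pi * t) - 1))) integrable_on {0..1}"
proof (rule measurable_bounded_by_integrable_imp_integrable)
  let ?g = "\<lambda>t::real. ln 2 + 2 * t powr (- 1 / 2) + 2 * (1 - t) powr (- 1 / 2)"
  have p: "(\<lambda>t::real. t powr (- 1 / 2)) integrable_on {0..1}"
    by (rule integrable_on_powr_from_0) auto
  then obtain i where "((\<lambda>t::real. t powr (- 1 / 2)) has_integral i) (cbox 0 1)" by auto
  from has_integral_affinity[OF this, of "- 1" 1]
  have "(\<lambda>t::real. (1 - t) powr (- 1 / 2)) integrable_on {0..1}"
    by (auto simp: algebra_simps image_affinity_atLeastAtMost_diff image_affinity_atLeastAtMost integrable_on_def)
  with p show "?g integrable_on {0..1}"
    by (intro integrable_add integrable_on_cmult_left) auto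
  show "(\<lambda>t. ln (cmod (cis (2 * pi * t) - 1))) \<in> borel_measurable (lebesgue_on {0..1})"
    using borel_measurable_ln_cmod_poly_cis[of "[:-1, 1:]"]
    by (auto intro!: measurable_restrict_space1 measurable_completion simp: algebra_simps)
  show "norm (ln (cmod (cis (2 * pi * t) - 1))) \<le> ?g t" if t: "t \<in> {0..1}" for t
  proof (cases "t = 0 \<or> t = 1")
    case True
    then show ?thesis by (auto simp: cis_2pi)
  next
    case False
    let ?m = "cmod (cis (2 * pi * t) - 1)"
    have pos: "0 < t" "t < 1" using False t by auto
    \<comment> \<open>The constant 4 is given away so that the logarithm of the lower bound is
      exactly \<open>ln t + ln (1 - t)\<close>.\<close>
    have "t * (1 - t) \<le> 2 * (2 * t * (1 - t))" using pos by simp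
    also have "\<dots> \<le> ?m" using sin_pi_ge[of t] pos by (simp add: cmod_cis_minus_one)
    finally have lower: "t * (1 - t) \<le> ?m" .
    have "0 < t * (1 - t)" using pos by simp
    with lower have "ln (t * (1 - t)) \<le> ln ?m" "0 < ?m" by (auto intro: ln_mono)
    moreover have "ln (t * (1 - t)) = ln t + ln (1 - t)" using pos by (simp add: ln_mult)
    moreover have "ln ?m \<le> ln 2"
      using \<open>0 < ?m\<close> by (intro ln_mono) (auto simp: cmod_cis_minus_one)
    moreover have "\<bar>ln t\<bar> \<le> 2 * t powr (- 1 / 2)" "\<bar>ln (1 - t)\<bar> \<le> 2 * (1 - t) powr (- 1 / 2)"
      using pos abs_ln_le_inverse_sqrt[of t] abs_ln_le_inverse_sqrt[of "1 - t"] by auto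
    moreover have "0 \<le> t powr (- 1 / 2)" "0 \<le> (1 - t) powr (- 1 / 2)" "0 \<le> ln (2::real)" by auto
    ultimately show ?thesis unfolding real_norm_def by linarith
  qed
qed auto

section \<open>Rotation and duplication formulas\<close>

lemma has_integral_ln_cmod_cis_rotate:
  assumes I: "((\<lambda>t. ln (cmod (cis (2 * pi * t) - 1))) has_integral I) {0..1}" and a: "cmod a = 1"
  shows "((\<lambda>t. ln (cmod (cis (2 * pi * t) - a))) has_integral I) {0..1}"
proof -
  \<comment> \<open>The shift is chosen so that \<open>a * cis (2 * pi * s) = 1\<close>: turning the
    circle by \<open>s\<close> carries the root \<open>a\<close> to 1.\<close>
  define s where "s = 1 - Arg2pi a / (2 * pi)"
  have s: "0 \<le> s" "s \<le> 1"
    using Arg2pi_ge_0[of a] Arg2pi_lt_2pi[of a] by (auto simp: s_def)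
  have "a = cis (2 * pi * (1 - s))"
    using Arg2pi_eq[of a] a by (simp add: s_def cis_conv_exp)
  then have as: "a * cis (2 * pi * s) = 1"
    by (simp add: cis_mult right_diff_distrib)
  have "cmod (cis (2 * pi * (t + s)) - 1) = cmod (cis (2 * pi * t) - a)" for t
  proof -
    have "cis (2 * pi * (t + s)) - 1 = cis (2 * pi * s) * (cis (2 * pi * t) - a)"
      using as by (simp add: algebra_simps flip: cis_mult)
    then show ?thesis by (simp add: norm_mult)
  qed
  moreover have "((\<lambda>t. ln (cmod (cis (2 * pi * (t + s)) - 1))) has_integral I) {0..1}"
    by (rule has_integral_periodic_shift[OF I _ s]) (simp only: cis_two_pi_periodic)
  ultimately show ?thesis by (simp only:)
qed

lemma integrable_ln_cmod_cis_minus: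
  "(\<lambda>t. ln (cmod (cis (2 * pi * t) - a))) integrable_on {0..1}"
proof (cases "cmod a = 1")
  case True
  then show ?thesis
    using has_integral_ln_cmod_cis_rotate integrable_ln_cmod_cis_minus_one
    unfolding integrable_on_def by blast
next
  case False
  then have "cis (2 * pi * t) \<noteq> a" for t by auto
  then show ?thesis by (intro integrable_continuous_real continuous_intros) auto
qed

text \<open>Replace \<open>z\<close> by its square, which preserves the integral, and factor
  \<open>z^2 - a^2 = (z - a) * (z + a)\<close>. The second factor has the same integral as the first
  because \<open>- z\<close> is \<open>z\<close> after half a turn.\<close>

lemma integral_ln_cmod_cis_minus_square:
  "integral {0..1} (\<lambda>t. ln (cmod (cis (2 * pi * t) - a\<^sup>2))) =
   2 * integral {0..1} (\<lambda>t. ln (cmod (cis (2 * pi * t) - a)))"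
proof -
  define f where "f = (\<lambda>b t. ln (cmod (cis (2 * pi * t) - b)))"
  have per: "f b (t + 1) = f b t" for b t
    by (simp only: f_def cis_two_pi_periodic)
  have hf: "(f b has_integral integral {0..1} (f b)) {0..1}" for b
    unfolding f_def by (rule integrable_integral[OF integrable_ln_cmod_cis_minus])
  let ?S = "{t \<in> {0..1}. poly [:- a\<^sup>2, 0, 1:] (cis (2 * pi * t)) = 0}"
  have "finite ?S" by (rule finite_unit_circle_roots) simp
  moreover have "f (a\<^sup>2) (2 * t) = f a t + f a (t + 1 / 2)" if "t \<in> {0..1} - ?S" for t
  proof -
    let ?z = "cis (2 * pi * t)"
    have "cis (2 * pi * (2 * t)) = ?z * ?z" by (simp add: cis_mult)
    then have "cis (2 * pi * (2 * t)) - a\<^sup>2 = (?z - a) * (?z + a)"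
      by (simp add: algebra_simps power2_eq_square)
    moreover have "?z * ?z - a * a \<noteq> 0"
      using that by (simp add: power2_eq_square)
    then have "(?z - a) * (?z + a) \<noteq> 0" by (simp add: algebra_simps)
    moreover have "cmod (cis (2 * pi * (t + 1 / 2)) - a) = cmod (?z + a)"
      unfolding cis_two_pi_half using norm_minus_cancel[of "?z + a"] by simp
    ultimately show ?thesis by (simp add: f_def norm_mult ln_mult)
  qed
  moreover have "((\<lambda>t. f a t + f a (t + 1 / 2)) has_integral
      integral {0..1} (f a) + integral {0..1} (f a)) {0..1}"
    by (intro has_integral_add hf has_integral_periodic_shift per) auto
  ultimately have "((\<lambda>t. f (a\<^sup>2) (2 * t)) has_integral
      integral {0..1} (f a) + integral {0..1} (f a)) {0..1}"
    by (rule has_integral_spike_finite)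
  from has_integral_unique[OF has_integral_periodic_double[OF hf per] this]
  show ?thesis by (simp add: f_def)
qed

text \<open>
  The duplication formula forces the integral to vanish: its values at \<open>a ^ 2 ^ k\<close> grow like \<open>2 ^ k\<close>
  but stay bounded if \<open>cmod a < 1\<close>, while \<open>a = 1\<close> is a fixed point of squaring.
\<close>

lemma has_integral_ln_cmod_cis_minus:
  assumes a: "cmod a \<le> 1"
  shows "((\<lambda>t. ln (cmod (cis (2 * pi * t) - a))) has_integral 0) {0..1}"
proof -
  define I where "I = (\<lambda>b. integral {0..1} (\<lambda>t. ln (cmod (cis (2 * pi * t) - b))))"
  have square: "I (b\<^sup>2) = 2 * I b" for b
    unfolding I_def by (rule integral_ln_cmod_cis_minus_square)
  have hI: "((\<lambda>t. ln (cmod (cis (2 * pi * t) - b))) has_integral I b) {0..1}" for b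
    unfolding I_def by (rule integrable_integral[OF integrable_ln_cmod_cis_minus])
  show ?thesis
  proof (cases "cmod a = 1")
    case True
    have "I 1 = 0" using square[of 1] by simp
    with True show ?thesis using has_integral_ln_cmod_cis_rotate[of 0 a] hI[of 1] by simp
  next
    case False
    \<comment> \<open>For \<open>cmod b \<le> cmod a < 1\<close> the distance from \<open>b\<close>
      to a point of the circle lies between \<open>1 - cmod a\<close> and 2, so \<open>C\<close>
      bounds all the logarithms.\<close>
    define C where "C = max (ln 2) (- ln (1 - cmod a))"
    have bound: "\<bar>I b\<bar> \<le> C" if b: "cmod b \<le> cmod a" for b
    proof -
      have "\<bar>ln (cmod (cis (2 * pi * t) - b))\<bar> \<le> C" for t
      proof -
        let ?m = "cmod (cis (2 * pi * t) - b)"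
        have "1 - cmod a \<le> ?m" "?m \<le> 2"
          using norm_triangle_ineq2[of "cis (2 * pi * t)" b] norm_triangle_ineq4[of "cis (2 * pi * t)" b]
            a b by auto
        moreover have "0 < 1 - cmod a" using a False by simp
        ultimately have "ln (1 - cmod a) \<le> ln ?m" "ln ?m \<le> ln 2" by (auto intro!: ln_mono)
        then show ?thesis by (auto simp: C_def)
      qed
      moreover have "0 \<le> C" by (simp add: C_def le_max_iff_disj)
      ultimately show ?thesis
        using has_integral_bound[of C "\<lambda>t. ln (cmod (cis (2 * pi * t) - b))" "I b" 0 1] hI[of b] by simp
    qed
    have iterate: "I (a ^ 2 ^ k) = 2 ^ k * I a" for k :: nat
    proof (induction k)
      case (Suc k)
      have "a ^ 2 ^ Suc k = (a ^ 2 ^ k)\<^sup>2" by (simp add: power_mult[symmetric] mult.commute)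
      then show ?case using square[of "a ^ 2 ^ k"] Suc by simp
    qed simp
    have "I a = 0"
    proof (rule ccontr)
      assume "I a \<noteq> 0"
      then obtain k where "C / \<bar>I a\<bar> < 2 ^ k"
        using real_arch_pow[of 2 "C / \<bar>I a\<bar>"] by auto
      then have "C < 2 ^ k * \<bar>I a\<bar>" using \<open>I a \<noteq> 0\<close> by (simp add: field_simps)
      moreover have "cmod (a ^ 2 ^ k) \<le> cmod a"
        using power_decreasing[of 1 "2 ^ k" "cmod a"] a by (simp add: norm_power)
      then have "2 ^ k * \<bar>I a\<bar> \<le> C" using bound[of "a ^ 2 ^ k"] iterate[of k] by (simp add: abs_mult)
      ultimately show False by simp
    qed
    then show ?thesis using hI[of a] by simp
  qed
qed

subsection \<open>Mahler measures of polynomials\<close>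

lemma complex_poly_root_induct [consumes 1, case_names const factor]:
  fixes P :: "complex poly"
  assumes "P \<noteq> 0"
    and const: "\<And>c. c \<noteq> 0 \<Longrightarrow> Q [:c:]"
    and factor: "\<And>a p. p \<noteq> 0 \<Longrightarrow> Q p \<Longrightarrow> Q ([:- a, 1:] * p)"
  shows "Q P"
  using assms(1)
proof (induction "degree P" arbitrary: P)
  case 0
  then obtain c where "P = [:c:]" by (metis degree_eq_zeroE)
  with 0 const show ?case by auto
next
  case (Suc n)
  then have "\<not> constant (poly P)" by (simp add: constant_degree)
  then obtain a where "poly P a = 0" using fundamental_theorem_of_algebra by blast
  then obtain p where p: "P = [:- a, 1:] * p" by (auto simp: poly_eq_0_iff_dvd elim: dvdE)
  with Suc.prems have "p \<noteq> 0" by auto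
  then have "degree P = Suc (degree p)" unfolding p by (subst degree_mult_eq) auto
  with Suc have "Q p" using \<open>p \<noteq> 0\<close> by auto
  then show ?case unfolding p by (rule factor[OF \<open>p \<noteq> 0\<close>])
qed

text \<open>The logarithm is additive away from the roots of the product; the convention
  \<open>ln 0 = 0\<close> spoils this only at finitely many \<open>t\<close>.\<close>

lemma has_integral_ln_cmod_poly_mult:
  assumes "P \<noteq> 0" "Q \<noteq> 0"
    and "((\<lambda>t. ln (cmod (poly P (cis (2 * pi * t))))) has_integral I) {0..1}"
    and "((\<lambda>t. ln (cmod (poly Q (cis (2 * pi * t))))) has_integral J) {0..1}"
  shows "((\<lambda>t. ln (cmod (poly (P * Q) (cis (2 * pi * t))))) has_integral (I + J)) {0..1}"
proof (rule has_integral_spike_finite)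
  show "finite {t \<in> {0..1}. poly (P * Q) (cis (2 * pi * t)) = 0}"
    by (rule finite_unit_circle_roots) (use assms in auto)
  show "((\<lambda>t. ln (cmod (poly P (cis (2 * pi * t)))) + ln (cmod (poly Q (cis (2 * pi * t)))))
      has_integral (I + J)) {0..1}"
    by (intro has_integral_add assms)
qed (auto simp: norm_mult ln_mult)

lemma integrable_ln_cmod_poly:
  assumes "P \<noteq> 0"
  shows "(\<lambda>t. ln (cmod (poly P (cis (2 * pi * t))))) integrable_on {0..1}"
  using assms
proof (induction P rule: complex_poly_root_induct)
  case (const c)
  then show ?case by auto
next
  case (factor a p)
  obtain I where "((\<lambda>t. ln (cmod (poly [:- a, 1:] (cis (2 * pi * t))))) has_integral I) {0..1}"
    using integrable_ln_cmod_cis_minus[of a] by (auto simp: integrable_on_def)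
  moreover obtain J where "((\<lambda>t. ln (cmod (poly p (cis (2 * pi * t))))) has_integral J) {0..1}"
    using factor.IH by (auto simp: integrable_on_def)
  ultimately show ?case
    using has_integral_ln_cmod_poly_mult[of "[:- a, 1:]" p I J] factor.hyps
    by (intro has_integral_integrable[of _ "I + J"]) auto
qed

text \<open>Each factor \<open>z - a\<close> with \<open>cmod a \<le> 1\<close> integrates to 0, so
  only the leading coefficient is left.\<close>

lemma has_integral_ln_cmod_poly_roots_in_disc:
  assumes "P \<noteq> 0" "\<And>z. poly P z = 0 \<Longrightarrow> cmod z \<le> 1"
  shows "((\<lambda>t. ln (cmod (poly P (cis (2 * pi * t))))) has_integral ln (cmod (lead_coeff P))) {0..1}"
  using assms
proof (induction P rule: complex_poly_root_induct)
  case (const c)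
  show ?case using has_integral_const_real[of "ln (cmod c)" 0 1] by simp
next
  case (factor a p)
  have "cmod a \<le> 1" using factor.prems[of a] by simp
  then have "((\<lambda>t. ln (cmod (poly [:- a, 1:] (cis (2 * pi * t))))) has_integral 0) {0..1}"
    using has_integral_ln_cmod_cis_minus[of a] by simp
  moreover have "((\<lambda>t. ln (cmod (poly p (cis (2 * pi * t))))) has_integral ln (cmod (lead_coeff p))) {0..1}"
    by (rule factor.IH, rule factor.prems) simp
  ultimately have "((\<lambda>t. ln (cmod (poly ([:- a, 1:] * p) (cis (2 * pi * t))))) has_integral
      0 + ln (cmod (lead_coeff p))) {0..1}"
    using factor.hyps by (intro has_integral_ln_cmod_poly_mult) auto
  moreover have "lead_coeff ([:- a, 1:] * p) = lead_coeff p"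
    unfolding lead_coeff_mult by simp
  ultimately show ?case by (simp only: add_0)
qed

text \<open>This passes from the Lebesgue integral of the definition to the gauge integral used
  above, which requires absolute integrability.\<close>

lemma mahler_measure_eq_exp_integral:
  assumes "P \<noteq> 0"
  shows "mahler_measure P = exp (integral {0..1} (\<lambda>t. ln (cmod (poly P (cis (2 * pi * t))))))"
proof -
  let ?f = "\<lambda>t. ln (cmod (poly P (cis (2 * pi * t))))"
  have "continuous_on {0..1} (\<lambda>t. cmod (poly P (cis (2 * pi * t))))"
    by (intro continuous_intros)
  then have "bdd_above ((\<lambda>t. cmod (poly P (cis (2 * pi * t)))) ` {0..1})"
    by (intro bounded_imp_bdd_above compact_imp_bounded compact_continuous_image) auto
  then obtain B where "\<forall>x \<in> (\<lambda>t. cmod (poly P (cis (2 * pi * t)))) ` {0..1}. x \<le> B"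
    unfolding bdd_above_def by blast
  then have B: "cmod (poly P (cis (2 * pi * t))) \<le> B" if "t \<in> {0..1}" for t
    using that by blast
  have bound: "?f t \<le> max 0 B" if "t \<in> {0..1}" for t
    using B[OF that] ln_bound[of "cmod (poly P (cis (2 * pi * t)))"]
    by (cases "poly P (cis (2 * pi * t)) = 0") auto
  have "(\<lambda>_. max 0 B) absolutely_integrable_on {0..1::real}"
    by (rule absolutely_integrable_on_const) simp
  \<comment> \<open>A gauge integrable function below an absolutely integrable one is absolutely
    integrable, so the singularities towards minus infinity need no separate estimate.\<close>
  from absolutely_integrable_absolutely_integrable_ubound[OF integrable_ln_cmod_poly[OF assms] this bound]
  have "?f absolutely_integrable_on {0..1}" .
  moreover have "(\<lambda>t. indicat_real {0..1} t *\<^sub>R ?f t) \<in> borel_measurable lborel"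
    using borel_measurable_ln_cmod_poly_cis[of P] by measurable
  ultimately have "set_integrable lborel {0..1} ?f"
    unfolding set_integrable_def using integrable_completion by blast
  then have "(LBINT t:{0..1}. ?f t) = integral {0..1} ?f"
    by (rule set_borel_integral_eq_integral)
  then show ?thesis
    by (simp add: mahler_measure_def cis_conv_exp mult_ac)
qed

lemma mahler_measure_cong:
  assumes "P \<noteq> 0" "Q \<noteq> 0" "\<And>z. cmod z = 1 \<Longrightarrow> cmod (poly P z) = cmod (poly Q z)"
  shows "mahler_measure P = mahler_measure Q"
  using assms by (simp add: mahler_measure_eq_exp_integral)

lemma mahler_measure_roots_in_disc:
  assumes "P \<noteq> 0" "\<And>z. poly P z = 0 \<Longrightarrow> cmod z \<le> 1"
  shows "mahler_measure P = cmod (lead_coeff P)"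
  using has_integral_ln_cmod_poly_roots_in_disc[OF assms] assms
  by (simp add: mahler_measure_eq_exp_integral integral_unique)

lemma mahler_measure_mono:
  assumes "R \<noteq> 0" "Q \<noteq> 0" "P \<noteq> 0"
    and le: "\<And>z. cmod z = 1 \<Longrightarrow> poly P z \<noteq> 0 \<Longrightarrow> cmod (poly R z) \<le> cmod (poly Q z)"
  shows "mahler_measure R \<le> mahler_measure Q"
proof -
  let ?f = "\<lambda>t. ln (cmod (poly R (cis (2 * pi * t))))"
  let ?g = "\<lambda>t. ln (cmod (poly Q (cis (2 * pi * t))))"
  let ?S = "{t \<in> {0..1}. poly (P * R) (cis (2 * pi * t)) = 0}"
  have "finite ?S" by (rule finite_unit_circle_roots) (use assms in auto)
  \<comment> \<open>At a root of \<open>R\<close> the value \<open>ln 0 = 0\<close> may exceed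
    \<open>?g t\<close>; redefining the integrand on \<open>?S\<close> restores the pointwise
    inequality.\<close>
  then have "((\<lambda>t. if t \<in> ?S then ?g t else ?f t) has_integral integral {0..1} ?f) {0..1}"
    by (rule has_integral_spike_finite)
       (use integrable_ln_cmod_poly assms in \<open>auto intro!: integrable_integral\<close>)
  moreover have "(?g has_integral integral {0..1} ?g) {0..1}"
    using integrable_ln_cmod_poly assms by (auto intro!: integrable_integral)
  moreover have "(if t \<in> ?S then ?g t else ?f t) \<le> ?g t" if "t \<in> {0..1}" for t
    using le[of "cis (2 * pi * t)"] that by (auto intro!: ln_mono)
  ultimately have "integral {0..1} ?f \<le> integral {0..1} ?g" by (rule has_integral_le)
  then show ?thesis using assms by (simp add: mahler_measure_eq_exp_integral)
qed

subsection \<open>Logarithmic derivatives on the unit circle\<close>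

definition log_deriv :: "complex poly \<Rightarrow> complex \<Rightarrow> complex" where
  "log_deriv P z = z * poly (pderiv P) z / poly P z"

lemma log_deriv_const: "log_deriv [:c:] z = 0"
  by (simp add: log_deriv_def pderiv_pCons)

lemma log_deriv_linear: "log_deriv [:- a, 1:] z = z / (z - a)"
  by (simp add: log_deriv_def pderiv_pCons)

lemma log_deriv_mult:
  assumes "poly P z \<noteq> 0" "poly Q z \<noteq> 0"
  shows "log_deriv (P * Q) z = log_deriv P z + log_deriv Q z"
  using assms by (simp add: log_deriv_def pderiv_mult field_simps)

text \<open>Polarization of \<open>cmod a = cmod (z - (z - a))\<close>. The real part is at least
  1/2 or at most 1/2 according to whether \<open>a\<close> is nearer to the origin than
  \<open>z\<close> or farther.\<close>

lemma Re_divide_diff_eq: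
  assumes "z \<noteq> a"
  shows "Re (z / (z - a)) = 1 / 2 + ((cmod z)\<^sup>2 - (cmod a)\<^sup>2) / (2 * (cmod (z - a))\<^sup>2)"
proof -
  have nz: "(cmod (z - a))\<^sup>2 \<noteq> 0" using assms by simp
  have "Re (z / (z - a)) = Re (z * cnj (z - a)) / (cmod (z - a))\<^sup>2"
    by (subst complex_div_cnj) (simp add: Re_divide_of_real flip: of_real_power)
  also have "Re (z * cnj (z - a)) = ((cmod (z - a))\<^sup>2 + ((cmod z)\<^sup>2 - (cmod a)\<^sup>2)) / 2"
    unfolding cmod_power2 by (simp add: power2_eq_square field_simps)
  finally show ?thesis using nz by (simp add: field_simps)
qed

lemma Re_log_deriv_ge:
  assumes "P \<noteq> 0" "\<And>a. poly P a = 0 \<Longrightarrow> cmod a \<le> 1" "1 < cmod z"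
  shows "real (degree P) / 2 \<le> Re (log_deriv P z)"
  using assms
proof (induction P rule: complex_poly_root_induct)
  case (const c)
  show ?case by (simp add: log_deriv_const)
next
  case (factor a p)
  have IH: "real (degree p) / 2 \<le> Re (log_deriv p z)"
    by (rule factor.IH) (use factor.prems in auto)
  have a: "cmod a \<le> 1" using factor.prems(1)[of a] by simp
  then have "z \<noteq> a" using factor.prems(2) by auto
  moreover have "(cmod a)\<^sup>2 \<le> (cmod z)\<^sup>2" using a factor.prems(2) by (intro power_mono) auto
  ultimately have "1 / 2 \<le> Re (log_deriv [:- a, 1:] z)"
    unfolding log_deriv_linear by (subst Re_divide_diff_eq) auto
  moreover have "poly p z \<noteq> 0" using factor.prems(1)[of z] factor.prems(2) by auto
  then have "log_deriv ([:- a, 1:] * p) z = log_deriv [:- a, 1:] z + log_deriv p z"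
    using \<open>z \<noteq> a\<close> by (intro log_deriv_mult) auto
  moreover have "degree ([:- a, 1:] * p) = Suc (degree p)"
    using factor.hyps by (subst degree_mult_eq) auto
  ultimately show ?case using IH by (simp del: mult_pCons_left)
qed

text \<open>Gauss--Lucas for the unit disc: at a critical point outside it the logarithmic
  derivative would be 0, yet every root contributes at least 1/2 to its real part.\<close>

lemma pderiv_roots_in_disc:
  assumes "0 < degree P" "\<And>a. poly P a = 0 \<Longrightarrow> cmod a \<le> 1" "poly (pderiv P) z = 0"
  shows "cmod z \<le> 1"
proof (rule ccontr)
  assume "\<not> cmod z \<le> 1"
  moreover have "P \<noteq> 0" using assms by auto
  ultimately have "real (degree P) / 2 \<le> Re (log_deriv P z)"
    using assms by (intro Re_log_deriv_ge) auto
  with assms show False by (simp add: log_deriv_def)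
qed

text \<open>
  \<open>Q\<close> is \<open>P\<close> with its roots outside the unit disc reflected to the inside, possibly times a power
  of \<open>z\<close>. The conditions on the logarithmic derivatives are additive, so they only need to be
  checked for linear factors.
\<close>

definition circle_majorant :: "complex poly \<Rightarrow> complex poly \<Rightarrow> bool" where
  "circle_majorant P Q \<longleftrightarrow> P \<noteq> 0 \<and> Q \<noteq> 0 \<and> (\<forall>z. poly Q z = 0 \<longrightarrow> cmod z \<le> 1) \<and>
     (\<forall>z. cmod z = 1 \<longrightarrow> cmod (poly Q z) = cmod (poly P z)) \<and>
     (\<forall>z. cmod z = 1 \<longrightarrow> poly P z \<noteq> 0 \<longrightarrow>
        Im (log_deriv Q z) = Im (log_deriv P z) \<and> Re (log_deriv P z) \<le> Re (log_deriv Q z) \<and>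
        real (degree Q) - Re (log_deriv P z) \<le> Re (log_deriv Q z))"

lemma circle_majorant_const: "c \<noteq> 0 \<Longrightarrow> circle_majorant [:c:] [:c:]"
  by (simp add: circle_majorant_def log_deriv_const)

text \<open>The padding factor \<open>z\<close> has modulus 1 on the circle and logarithmic
  derivative 1; it raises the degree of the majorant.\<close>

lemma circle_majorant_one_linear: "circle_majorant 1 [:0, 1:]"
  using log_deriv_const[of 1] log_deriv_linear[of 0]
  by (auto simp: circle_majorant_def one_pCons)

lemma circle_majorant_linear: "\<exists>Q. degree Q = 1 \<and> circle_majorant [:- a, 1:] Q"
proof (cases "cmod a \<le> 1")
  case True
  have "1 / 2 \<le> Re (z / (z - a))" if "cmod z = 1" "z \<noteq> a" for z
    using that True power_mono[of "cmod a" 1 2] by (subst Re_divide_diff_eq) auto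
  then have "1 - Re (z / (z - a)) \<le> Re (z / (z - a))" if "cmod z = 1" "z \<noteq> a" for z
    using that by fastforce
  with True have "circle_majorant [:- a, 1:] [:- a, 1:]"
    by (auto simp: circle_majorant_def log_deriv_linear)
  then show ?thesis by (intro exI[of _ "[:- a, 1:]"]) auto
next
  case False
  \<comment> \<open>The root becomes \<open>1 / cnj a\<close>, the reflection of \<open>a\<close> in
    the circle. With \<open>w = z / (z - a)\<close> the logarithmic derivative turns into
    \<open>1 - cnj w\<close>: the imaginary part is kept, and \<open>Re w\<close> becomes
    \<open>1 - Re w\<close>, which is no smaller as \<open>Re w \<le> 1 / 2\<close>.\<close>
  let ?Q = "[:1, - cnj a:]"
  have a0: "a \<noteq> 0" using False by auto
  have root: "cmod z \<le> 1" if "poly ?Q z = 0" for z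
  proof -
    have "z * cnj a = 1" using that by simp
    then have "cmod z * cmod a = 1" by (metis complex_mod_cnj norm_mult norm_one)
    then show ?thesis using False
      by (metis linorder_not_le mult_less_cancel_left_disj mult.right_neutral norm_ge_zero order_less_le_trans order.asym)
  qed
  have circle: "1 - cnj a * z = z * cnj (z - a)" if "cmod z = 1" for z
  proof -
    have "z * cnj z = 1" using that complex_norm_square[of z] by simp
    then show ?thesis by (simp add: algebra_simps)
  qed
  have ld: "log_deriv ?Q z = 1 - cnj (z / (z - a))" if "cmod z = 1" "z \<noteq> a" for z
  proof -
    have z: "z * cnj z = 1" "z \<noteq> 0" using that complex_norm_square[of z] by auto
    have nz: "cnj z - cnj a \<noteq> 0" using that by simp
    have "log_deriv ?Q z = - (cnj a * z) / (z * cnj (z - a))"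
      using circle[OF that(1)] by (simp add: log_deriv_def pderiv_pCons mult.commute)
    also have "\<dots> = - cnj a / (cnj z - cnj a)" using z by simp
    also have "\<dots> = 1 - cnj (z / (z - a))" using nz by (simp add: field_simps)
    finally show ?thesis .
  qed
  have "Re (z / (z - a)) \<le> 1 / 2" if "cmod z = 1" "z \<noteq> a" for z
    using that False power_mono[of 1 "cmod a" 2]
    by (subst Re_divide_diff_eq) (auto simp: divide_le_0_iff)
  then have "Re (z / (z - a)) \<le> 1 - Re (z / (z - a))" if "cmod z = 1" "z \<noteq> a" for z
    using that by fastforce
  moreover have "cmod (poly ?Q z) = cmod (poly [:- a, 1:] z)" if "cmod z = 1" for z
    using circle[OF that] that by (simp add: norm_mult mult.commute flip: complex_cnj_diff)
  ultimately have "circle_majorant [:- a, 1:] ?Q"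
    unfolding circle_majorant_def using root a0
    by (auto simp: log_deriv_linear ld simp del: complex_cnj_divide)
  then show ?thesis using a0 by (intro exI[of _ ?Q]) auto
qed

lemma circle_majorant_mult:
  assumes "circle_majorant P Q" "circle_majorant P' Q'"
  shows "circle_majorant (P * P') (Q * Q')"
proof -
  have nz: "P \<noteq> 0" "Q \<noteq> 0" "P' \<noteq> 0" "Q' \<noteq> 0" using assms by (auto simp: circle_majorant_def)
  have "Im (log_deriv (Q * Q') z) = Im (log_deriv (P * P') z) \<and>
      Re (log_deriv (P * P') z) \<le> Re (log_deriv (Q * Q') z) \<and>
      real (degree (Q * Q')) - Re (log_deriv (P * P') z) \<le> Re (log_deriv (Q * Q') z)"
    if z: "cmod z = 1" "poly (P * P') z \<noteq> 0" for z
  proof -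
    have p: "poly P z \<noteq> 0" "poly P' z \<noteq> 0" using z by auto
    have q: "poly Q z \<noteq> 0" "poly Q' z \<noteq> 0"
      using p z assms unfolding circle_majorant_def by (metis norm_eq_zero)+
    note m = assms[unfolded circle_majorant_def]
    have "Im (log_deriv Q z) = Im (log_deriv P z)" "Re (log_deriv P z) \<le> Re (log_deriv Q z)"
        "real (degree Q) - Re (log_deriv P z) \<le> Re (log_deriv Q z)"
        "Im (log_deriv Q' z) = Im (log_deriv P' z)" "Re (log_deriv P' z) \<le> Re (log_deriv Q' z)"
        "real (degree Q') - Re (log_deriv P' z) \<le> Re (log_deriv Q' z)"
      using m p z by blast+
    then show ?thesis
      by (simp add: log_deriv_mult p q degree_mult_eq nz)
  qed
  with assms show ?thesis
    unfolding circle_majorant_def by (auto simp: norm_mult)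
qed

lemma circle_majorant_exists:
  assumes "P \<noteq> 0" "degree P \<le> d"
  obtains Q where "degree Q = d" "circle_majorant P Q"
proof -
  have ex: "\<exists>Q. degree Q = degree P \<and> circle_majorant P Q"
    using assms(1)
  proof (induction P rule: complex_poly_root_induct)
    case (const c)
    then show ?case using circle_majorant_const by blast
  next
    case (factor a p)
    then obtain Q where Q: "degree Q = degree p" "circle_majorant p Q" by blast
    obtain L where L: "degree L = 1" "circle_majorant [:- a, 1:] L"
      using circle_majorant_linear by blast
    have "circle_majorant ([:- a, 1:] * p) (L * Q)"
      using L Q by (intro circle_majorant_mult)
    moreover have "degree (L * Q) = degree ([:- a, 1:] * p)"
      using L Q factor.hyps by (subst (1 2) degree_mult_eq) (auto simp: circle_majorant_def)
    ultimately show ?case by blast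
  qed
  \<comment> \<open>Padding reaches any prescribed degree \<open>d\<close>, which may exceed
    \<open>degree P\<close> when the last coefficient of the sum vanishes.\<close>
  have "\<exists>Q. degree Q = degree P + k \<and> circle_majorant P Q" for k
  proof (induction k)
    case 0
    then show ?case using ex by simp
  next
    case (Suc k)
    then obtain Q where Q: "degree Q = degree P + k" "circle_majorant P Q" by blast
    then have "circle_majorant (1 * P) ([:0, 1:] * Q)"
      by (intro circle_majorant_mult circle_majorant_one_linear)
    moreover have "degree ([:0, 1:] * Q) = degree P + Suc k"
      using Q by (subst degree_mult_eq) (auto simp: circle_majorant_def)
    ultimately show ?case by (intro exI[of _ "[:0, 1:] * Q"]) (simp only: mult_1)
  qed
  from this[of "d - degree P"] assms that show ?thesis by auto
qed

section \<open>Mahler's inequality for the derivative and its companion\<close>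

lemma circle_majorant_bounds:
  assumes "circle_majorant P Q" "cmod z = 1" "poly P z \<noteq> 0"
  shows "cmod (poly (pCons 0 (pderiv P)) z) \<le> cmod (poly (pderiv Q) z)"
    and "cmod (poly (smult (of_nat (degree Q)) P - pCons 0 (pderiv P)) z) \<le> cmod (poly (pderiv Q) z)"
proof -
  note m = assms(1)[unfolded circle_majorant_def]
  let ?u = "log_deriv P z" and ?v = "log_deriv Q z" and ?d = "real (degree Q)"
  have PQ: "cmod (poly Q z) = cmod (poly P z)" using m assms by blast
  have im: "Im ?v = Im ?u" and re: "Re ?u \<le> Re ?v" "?d - Re ?u \<le> Re ?v" using m assms by blast+
  have "poly Q z \<noteq> 0" using PQ assms(3) by auto
  then have "poly Q z * ?v = z * poly (pderiv Q) z" by (simp add: log_deriv_def)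
  from arg_cong[OF this, of cmod]
  have v: "cmod (poly (pderiv Q) z) = cmod (poly P z) * cmod ?v"
    using assms(2) PQ by (simp add: norm_mult)
  have u: "z * poly (pderiv P) z = poly P z * ?u" using assms(3) by (simp add: log_deriv_def)
  \<comment> \<open>After division by the common modulus of \<open>P\<close> and \<open>Q\<close>,
    it remains to compare \<open>?u\<close> and \<open>?d - ?u\<close> with \<open>?v\<close>. Since
    \<open>?d\<close> is nonnegative, the two inequalities in \<open>re\<close> also bound
    \<open>- Re ?u\<close> and \<open>Re ?u - ?d\<close> by \<open>Re ?v\<close>.\<close>
  have "\<bar>Re ?u\<bar> \<le> \<bar>Re ?v\<bar>" "\<bar>Re (of_nat (degree Q) - ?u)\<bar> \<le> \<bar>Re ?v\<bar>" using re by auto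
  moreover have "\<bar>Im ?u\<bar> \<le> \<bar>Im ?v\<bar>" "\<bar>Im (of_nat (degree Q) - ?u)\<bar> \<le> \<bar>Im ?v\<bar>" using im by auto
  ultimately have le: "cmod ?u \<le> cmod ?v" "cmod (of_nat (degree Q) - ?u) \<le> cmod ?v"
    unfolding cmod_def by (auto intro!: real_sqrt_le_mono add_mono simp: abs_le_square_iff)
  show "cmod (poly (pCons 0 (pderiv P)) z) \<le> cmod (poly (pderiv Q) z)"
    using le by (simp add: u v norm_mult mult_left_mono)
  have "poly (smult (of_nat (degree Q)) P - pCons 0 (pderiv P)) z = poly P z * (of_nat (degree Q) - ?u)"
    by (simp add: u algebra_simps)
  then show "cmod (poly (smult (of_nat (degree Q)) P - pCons 0 (pderiv P)) z) \<le> cmod (poly (pderiv Q) z)"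
    using le by (simp add: v norm_mult mult_left_mono)
qed

lemma mahler_measure_pderiv_circle_majorant:
  assumes "circle_majorant P Q" "0 < degree Q"
  shows "pderiv Q \<noteq> 0" "mahler_measure (pderiv Q) = real (degree Q) * mahler_measure P"
proof -
  note m = assms(1)[unfolded circle_majorant_def]
  show nz: "pderiv Q \<noteq> 0" using assms(2) by (simp add: pderiv_eq_0_iff)
  have "mahler_measure P = mahler_measure Q"
    using m by (intro mahler_measure_cong) auto
  also have "\<dots> = cmod (lead_coeff Q)"
    using m by (intro mahler_measure_roots_in_disc) auto
  finally have "mahler_measure P = cmod (lead_coeff Q)" .
  moreover have "cmod z \<le> 1" if "poly (pderiv Q) z = 0" for z
    using pderiv_roots_in_disc[OF assms(2) _ that] m by blast
  with nz have "mahler_measure (pderiv Q) = cmod (lead_coeff (pderiv Q))"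
    by (rule mahler_measure_roots_in_disc)
  moreover have "lead_coeff (pderiv Q) = of_nat (Suc (degree Q - 1)) * coeff Q (Suc (degree Q - 1))"
    unfolding degree_pderiv coeff_pderiv ..
  then have "lead_coeff (pderiv Q) = of_nat (degree Q) * lead_coeff Q"
    using assms(2) by simp
  ultimately show "mahler_measure (pderiv Q) = real (degree Q) * mahler_measure P"
    by (simp add: norm_mult)
qed

text \<open>The zero polynomial is excluded because \<open>ln 0 = 0\<close> would give it Mahler
  measure 1.\<close>

lemma
  assumes "P \<noteq> 0" "degree P \<le> d" "0 < d"
  shows mahler_measure_pderiv_le:
      "pCons 0 (pderiv P) \<noteq> 0 \<Longrightarrow> mahler_measure (pCons 0 (pderiv P)) \<le> real d * mahler_measure P"
    and mahler_measure_diff_pderiv_le: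
      "smult (of_nat d) P - pCons 0 (pderiv P) \<noteq> 0 \<Longrightarrow>
       mahler_measure (smult (of_nat d) P - pCons 0 (pderiv P)) \<le> real d * mahler_measure P"
proof -
  obtain Q where Q: "degree Q = d" "circle_majorant P Q"
    using circle_majorant_exists assms by blast
  note M = mahler_measure_pderiv_circle_majorant[OF Q(2), unfolded Q(1), OF assms(3)]
  note le = circle_majorant_bounds[OF Q(2), unfolded Q(1)]
  show "mahler_measure (pCons 0 (pderiv P)) \<le> real d * mahler_measure P" if "pCons 0 (pderiv P) \<noteq> 0"
    using mahler_measure_mono[OF that M(1) assms(1)] le(1) M(2) by simp
  show "mahler_measure (smult (of_nat d) P - pCons 0 (pderiv P)) \<le> real d * mahler_measure P"
    if "smult (of_nat d) P - pCons 0 (pderiv P) \<noteq> 0"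
    using mahler_measure_mono[OF that M(1) assms(1)] le(2) M(2) by simp
qed

subsection \<open>Polynomials with few terms\<close>

lemma coeff_sum_monom_inj_on:
  assumes "finite S" "inj_on m S" "k \<in> S"
  shows "coeff (\<Sum>n\<in>S. monom (c n) (m n)) (m k) = c k"
proof -
  have "coeff (\<Sum>n\<in>S. monom (c n) (m n)) (m k) = (\<Sum>n\<in>S. if n = k then c n else 0)"
    unfolding coeff_sum using assms by (intro sum.cong) (auto dest: inj_onD)
  then show ?thesis using assms by simp
qed

lemma pCons_pderiv_monom: "pCons 0 (pderiv (monom a k)) = monom (of_nat k * a) k"
  for a :: complex
  by (cases k) (auto simp: pderiv_monom simp flip: monom_Suc)

lemma smult_sum_right: "smult a (sum f S) = (\<Sum>n\<in>S. smult a (f n))"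
  by (induction S rule: infinite_finite_induct) (auto simp: smult_add_right)

lemma pCons_pderiv_sum: "pCons 0 (pderiv (sum f S)) = (\<Sum>n\<in>S. pCons 0 (pderiv (f n)))"
  for f :: "'a \<Rightarrow> complex poly"
proof (induction S rule: infinite_finite_induct)
  case (insert x F)
  have "pCons 0 (pderiv (f x) + pderiv (sum f F)) = pCons 0 (pderiv (f x)) + pCons 0 (pderiv (sum f F))"
    by simp
  then show ?case using insert by (simp add: pderiv_add)
qed auto

lemma mahler_measure_monom: "a \<noteq> 0 \<Longrightarrow> mahler_measure (monom a k) = cmod a"
  using mahler_measure_cong[of "monom a k" "[:a:]"] mahler_measure_roots_in_disc[of "[:a:]"]
  by (simp add: poly_monom norm_mult norm_power)

lemma norm_coeff_le_mahler_measure: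
  assumes "strict_mono_on {0..N} m" "(\<Sum>n = 0..N. monom (c n) (m n)) \<noteq> 0" "n \<le> N"
  shows "cmod (c n) \<le> real (N choose n) * mahler_measure (\<Sum>n = 0..N. monom (c n) (m n))"
  using assms
proof (induction N arbitrary: m c n)
  case 0
  then show ?case by (simp add: mahler_measure_monom)
next
  case (Suc N)
  note mono = strict_mono_onD[OF Suc.prems(1)]
  have m0: "m 0 \<le> m n" if "n \<le> Suc N" for n
    using that mono[of 0 n] by (cases "n = 0") auto
  have mN: "m n \<le> m (Suc N)" if "n \<le> Suc N" for n
    using that mono[of n "Suc N"] by (cases "n = Suc N") auto
  define P where "P = (\<Sum>n = 0..Suc N. monom (c n) (m n))"
  \<comment> \<open>Dividing by \<open>z ^ m 0\<close> makes the lowest exponent 0, so that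
    \<open>z * p'\<close> loses its first term.\<close>
  define p where "p = (\<Sum>n = 0..Suc N. monom (c n) (m n - m 0))"
  define d where "d = m (Suc N) - m 0"
  have "0 < d" using mono[of 0 "Suc N"] by (simp add: d_def)
  have P: "P = monom 1 (m 0) * p"
    unfolding P_def p_def sum_distrib_left using m0 by (intro sum.cong) (auto simp: mult_monom)
  have "P \<noteq> 0" using Suc.prems by (simp add: P_def)
  then have "p \<noteq> 0" using P by auto
  have M: "mahler_measure p = mahler_measure P"
    using \<open>P \<noteq> 0\<close> \<open>p \<noteq> 0\<close>
    by (intro mahler_measure_cong) (auto simp: P poly_monom norm_mult norm_power)
  have deg: "degree p \<le> d"
    unfolding p_def d_def using mN
    by (intro degree_sum_le) (auto intro!: order.trans[OF degree_monom_le] diff_le_mono)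

  \<comment> \<open>The induction hypothesis for a reduced polynomial \<open>R\<close> with
    \<open>N + 1\<close> terms. If \<open>R\<close> vanishes, distinct exponents force all its
    coefficients to be 0.\<close>
  have bound: "cmod (b k) \<le> real (N choose k) * (real d * mahler_measure P)"
    if R: "R = (\<Sum>n = 0..N. monom (b n) (l n))" and l: "strict_mono_on {0..N} l" and k: "k \<le> N"
      and le: "R \<noteq> 0 \<Longrightarrow> mahler_measure R \<le> real d * mahler_measure p" for R b l k
  proof (cases "R = 0")
    case True
    have "b k = coeff R (l k)"
      unfolding R using k l by (subst coeff_sum_monom_inj_on) (auto intro: strict_mono_on_imp_inj_on)
    then show ?thesis using True by (simp add: mahler_measure_def)
  next
    case False
    then have "cmod (b k) \<le> real (N choose k) * mahler_measure R"
      using Suc.IH[OF l _ k, of b] R by simp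
    also have "\<dots> \<le> real (N choose k) * (real d * mahler_measure P)"
      using le[OF False] M by (intro mult_left_mono) auto
    finally show ?thesis .
  qed

  have euler: "pCons 0 (pderiv p) = (\<Sum>n = 0..Suc N. monom (of_nat (m n - m 0) * c n) (m n - m 0))"
    unfolding p_def pCons_pderiv_sum pCons_pderiv_monom ..
  have low: "cmod (of_nat (m (Suc k) - m 0) * c (Suc k)) \<le> real (N choose k) * (real d * mahler_measure P)"
    if "k \<le> N" for k
  proof (rule bound[where R = "pCons 0 (pderiv p)" and l = "\<lambda>k. m (Suc k) - m 0"])
    \<comment> \<open>The weight at \<open>n = 0\<close> is 0, so that term drops out and the
      indices shift by one.\<close>
    show "pCons 0 (pderiv p) = (\<Sum>k = 0..N. monom (of_nat (m (Suc k) - m 0) * c (Suc k)) (m (Suc k) - m 0))"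
      unfolding euler by (subst sum.atLeast0_atMost_Suc_shift) simp
    show "strict_mono_on {0..N} (\<lambda>k. m (Suc k) - m 0)"
      using mono m0 by (intro strict_mono_onI diff_less_mono) auto
  qed (use that mahler_measure_pderiv_le[OF \<open>p \<noteq> 0\<close> deg \<open>0 < d\<close>] in auto)
  have high: "cmod (of_nat (m (Suc N) - m k) * c k) \<le> real (N choose k) * (real d * mahler_measure P)"
    if "k \<le> N" for k
  proof (rule bound[where R = "smult (of_nat d) p - pCons 0 (pderiv p)" and l = "\<lambda>k. m k - m 0"
        and b = "\<lambda>k. of_nat (m (Suc N) - m k) * c k"])
    \<comment> \<open>The weight \<open>d - (m n - m 0)\<close> equals
      \<open>m (Suc N) - m n\<close>, which vanishes at the last index.\<close>
    have "smult (of_nat d) p - pCons 0 (pderiv p) =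
        (\<Sum>n = 0..Suc N. monom (of_nat (m (Suc N) - m n) * c n) (m n - m 0))"
      unfolding euler unfolding p_def smult_sum_right sum_subtractf[symmetric]
    proof (intro sum.cong refl)
      fix n assume "n \<in> {0..Suc N}"
      then have "d = (m (Suc N) - m n) + (m n - m 0)" using m0[of n] mN[of n] by (simp add: d_def)
      then show "smult (of_nat d) (monom (c n) (m n - m 0)) - monom (of_nat (m n - m 0) * c n) (m n - m 0)
          = monom (of_nat (m (Suc N) - m n) * c n) (m n - m 0)"
        by (simp add: smult_monom diff_monom algebra_simps)
    qed
    then show "smult (of_nat d) p - pCons 0 (pderiv p) =
        (\<Sum>n = 0..N. monom (of_nat (m (Suc N) - m n) * c n) (m n - m 0))" by simp
    show "strict_mono_on {0..N} (\<lambda>k. m k - m 0)"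
      using mono m0 by (intro strict_mono_onI diff_less_mono) auto
  qed (use that mahler_measure_diff_pderiv_le[OF \<open>p \<noteq> 0\<close> deg \<open>0 < d\<close>] in auto)

  have "real d * cmod (c n) \<le> real d * (real (Suc N choose n) * mahler_measure P)"
  proof -
    have "real d = real (m n - m 0) + real (m (Suc N) - m n)"
      using m0[of n] mN[of n] Suc.prems(3) by (simp add: d_def)
    then have split: "real d * cmod (c n) =
        cmod (of_nat (m n - m 0) * c n) + cmod (of_nat (m (Suc N) - m n) * c n)"
      by (simp add: norm_mult distrib_right)
    \<comment> \<open>An interior index uses both bounds and Pascal's rule; at either end one weight
      is 0 and a single bound suffices.\<close>
    consider "n = 0" | k where "n = Suc k" "k < N" | "n = Suc N"
      using Suc.prems(3) by (cases n) fastforce+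
    then show ?thesis
    proof cases
      case 1
      then show ?thesis using split high[of 0] by simp
    next
      case 2
      then show ?thesis using split low[of k] high[of "Suc k"] by (simp add: algebra_simps)
    next
      case 3
      then show ?thesis using split low[of N] by simp
    qed
  qed
  then show ?case using \<open>0 < d\<close> by (simp add: P_def)
qed

theorem theorem1p1:
  fixes N :: nat and c :: "nat \<Rightarrow> complex" and m :: "nat \<Rightarrow> nat" and P :: "complex poly"
  assumes "strict_mono_on {0..N} m"
    and "P = (\<Sum>n = 0..N. monom (c n) (m n))"
    and "P \<noteq> 0"
  shows "\<forall>n \<in> {0..N}. cmod (c n) \<le> real (N choose n) * mahler_measure P"
  using norm_coeff_le_mahler_measure[of N m c] assms by simp

end
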